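(* Let $F=f+h$ on $\mathbb{R}^{n}$, where $f:\mathbb{R}^n\to\mathbb{R}$ is $\sigma$-strongly convex ($\sigma\ge 0$) and $L$-smooth ($L\ge 0$), $h:\mathbb{R}^n\to\mathbb{R}$ is convex with a given $(1/\mu)$-smooth approximation $\widetilde h(\cdot,\mu)$ with parameters $(\alpha,\beta)$, and $F$ has a minimizer $x^*$. Let $\widetilde F(x,\mu)=f(x)+\widetilde h(x,\mu)$. Let $\mu:[t_0,+\infty)\to(0,+\infty)$ satisfy $\dot\mu(t)\le 0$ and $\mu(t)\to 0$ as $t\to+\infty$. Let $x(\cdot)$ be a solution of $\dot x(t)=-\nabla_x\widetilde F(x(t),\mu(t))$ on $[t_0,+\infty)$. Then $\lim_{t\to+\infty}F(x(t))=F(x^* )$. Especially, if $\int_{t_0}^{+\infty}e^{\sigma(\tau-t_0)}\mu(\tau)\,d\tau<+\infty$, then $$F(x(t))-F(x^* )=\begin{cases}\mathcal{O}(e^{-\sigma t})&(\sigma>0),\\ \mathcal{O}(1/t)&(\sigma=0).\end{cases}$$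
   Context: A function is $L$-smooth if it is differentiable with $L$-Lipschitz gradient (Euclidean norm). A function $f$ is $\sigma$-strongly convex with $\sigma\ge 0$ if $f-\frac{\sigma}{2}\|\cdot\|_2^2$ is convex ($\sigma=0$ means merely convex). Let $h:\mathbb{R}^n\to\mathbb{R}$ be convex. A family of convex differentiable functions $\widetilde h(\cdot,\mu):\mathbb{R}^n\to\mathbb{R}$ ($\mu>0$) is a $(1/\mu)$-smooth approximation of $h$ with parameters $(\alpha,\beta)$ ($\alpha,\beta>0$) if for every $\mu>0$: (1) $\widetilde h(x,\mu)\le h(x)\le\widetilde h(x,\mu)+\beta\mu$ for all $x\in\mathbb{R}^n$; (2) $\widetilde h(\cdot,\mu)$ is $(\alpha/\mu)$-smooth. $a(t)=\mathcal{O}(b(t))$ means there exist $C>0$ and $T\ge t_0$ with $a(t)\le C\,b(t)$ for all $t\ge T$. *)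

theory Defs
  imports "HOL-Analysis.Analysis"
begin

text \<open>The (total) gradient operator; meaningful at points of differentiability, see
  \<open>GDERIV_grad\<close> below.\<close>

definition grad :: "('a::euclidean_space \<Rightarrow> real) \<Rightarrow> 'a \<Rightarrow> 'a" where
  "grad f x = (THE g. GDERIV f x :> g)"

lemma GDERIV_unique_euclidean:
  fixes f :: "'a::euclidean_space \<Rightarrow> real"
  assumes "GDERIV f x :> g" "GDERIV f x :> g'"
  shows "g = g'"
proof -
  have "(\<lambda>h. inner h g) = (\<lambda>h. inner h g')"
    using assms unfolding gderiv_def by (rule has_derivative_unique)
  then have "\<And>h. inner h g = inner h g'"
    by (rule fun_cong)
  then show ?thesis
    by (rule vector_eq_ldot [THEN iffD1, OF allI])
qed

lemma GDERIV_grad: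
  fixes f :: "'a::euclidean_space \<Rightarrow> real"
  assumes "f differentiable (at x)"
  shows "GDERIV f x :> grad f x"
proof -
  obtain D where D: "(f has_derivative D) (at x)"
    using assms by (auto simp: differentiable_def)
  then interpret bounded_linear D
    by (rule has_derivative_bounded_linear)
  have "D = (\<lambda>h. inner h (adjoint D 1))"
    using adjoint_works [OF linear_axioms, of _ "1::real"] by (auto simp: fun_eq_iff)
  with D have "GDERIV f x :> adjoint D 1"
    by (simp add: gderiv_def)
  then show ?thesis
    unfolding grad_def by (rule theI) (blast intro: GDERIV_unique_euclidean \<open>GDERIV f x :> adjoint D 1\<close>)
qed

definition smooth_fun :: "real \<Rightarrow> ('a::euclidean_space \<Rightarrow> real) \<Rightarrow> bool" where
  "smooth_fun L f \<longleftrightarrow> (\<forall>x. f differentiable (at x)) \<and> L-lipschitz_on UNIV (grad f)"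

definition strongly_convex :: "real \<Rightarrow> ('a::euclidean_space \<Rightarrow> real) \<Rightarrow> bool" where
  "strongly_convex \<sigma> f \<longleftrightarrow>
     0 \<le> \<sigma> \<and> convex_on UNIV (\<lambda>x. f x - \<sigma> / 2 * (norm x)\<^sup>2)"

text \<open>Only regularity in \<open>x\<close> is required of \<open>ht x m\<close>; nothing is assumed about its dependence
  on the smoothing parameter \<open>m\<close> beyond the two-sided bound.\<close>

definition smooth_approximation ::
    "real \<Rightarrow> real \<Rightarrow> ('a::euclidean_space \<Rightarrow> real) \<Rightarrow> ('a \<Rightarrow> real \<Rightarrow> real) \<Rightarrow> bool" where
  "smooth_approximation \<alpha> \<beta> h ht \<longleftrightarrow>
     0 < \<alpha> \<and> 0 < \<beta> \<and> convex_on UNIV h \<and>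
     (\<forall>m>0. convex_on UNIV (\<lambda>x. ht x m) \<and>
            (\<forall>x. ht x m \<le> h x \<and> h x \<le> ht x m + \<beta> * m) \<and>
            smooth_fun (\<alpha> / m) (\<lambda>x. ht x m))"

text \<open>One-sided, without absolute values, unlike the library's Landau symbols.\<close>

definition bigO_from :: "real \<Rightarrow> (real \<Rightarrow> real) \<Rightarrow> (real \<Rightarrow> real) \<Rightarrow> bool" where
  "bigO_from t0 a b \<longleftrightarrow> (\<exists>C>0. \<exists>T\<ge>t0. \<forall>t\<ge>T. a t \<le> C * b t)"

end

theory Submission
  imports Defs
begin

text \<open>
  Write \<open>\<epsilon>(t) = \<beta> \<mu>(t)\<close>. The two-sided bound between \<open>h\<close> and its smoothing turns the gradient of
  \<open>Ft(\<cdot>, \<mu>(t))\<close> into an \<open>\<epsilon>(t)\<close>-subgradient of \<open>F\<close>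
  (\<open>smoothed_gradient_is_approximate_subgradient\<close>), so the trajectory satisfies, for every point \<open>y\<close>,
  \<open>d/dt |x - y|^2/2 \<le> F(y) + \<epsilon>(t) - F(x) - \<sigma>/2 |x - y|^2\<close>. The whole argument rests on this
  inequality.

  With \<open>y\<close> the minimizer, it bounds weighted time averages of \<open>F(x) - F(xstar)\<close>. Passing from
  averages to pointwise values requires control of how much \<open>F(x)\<close> can increase. Within
  the two-sided bound the smoothings may vary with \<open>\<mu>\<close> in an arbitrary way, so \<open>Ft(x(t), \<mu>(t)) + \<beta> \<mu>(t)\<close> need not be monotone,
  and \<open>F(x)\<close> can increase. The key fact, \<open>approximate_subgradient_flow_rise\<close>, is that in finite
  dimension the total increase after time \<open>s\<close> is at most \<open>N \<epsilon>(s)\<close>, with \<open>N\<close> depending on the space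
  only. Whenever \<open>F(x)\<close> exceeds \<open>F(y)\<close> by at least \<open>\<epsilon>\<close>, the trajectory does not move away from \<open>y\<close>. If \<open>F(x)\<close>
  climbed through many levels spaced by \<open>\<epsilon>\<close>, the points at which it leaves these levels for the last
  time would form a sequence in which every point is approached by all later ones; a packing argument on
  the unit sphere bounds the length of such a sequence.

  Substituting \<open>F(x(\<tau>)) \<ge> F(x(t)) - N \<epsilon>(\<tau>)\<close> into the inequality for the minimizer and integrating over
  \<open>[t0, t]\<close> with weight \<open>exp(\<sigma> (\<tau> - t0))\<close> gives (\<open>approximate_subgradient_flow_energy\<close>)
  \<open>(F(x(t)) - F(xstar)) W(t) \<le> |x(t0) - xstar|^2/2 + (N + 1) M(t)\<close>, where \<open>W\<close> is the integral of the
  weight and \<open>M\<close> that of the weight times \<open>\<epsilon>\<close>. If the weighted integral of \<open>\<mu>\<close> is finite, the right side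
  is bounded and the rate is \<open>1/W(t)\<close>. For the limit alone the weight \<open>1\<close> suffices: the averages of \<open>\<mu>\<close>
  tend to \<open>0\<close> because \<open>\<mu>\<close> does.
\<close>

section \<open>Sequences approaching all their earlier points\<close>

lemma norm_diff_squared:
  fixes x y :: "'a::real_inner"
  shows "(norm (x - y))\<^sup>2 = (norm x)\<^sup>2 + (norm y)\<^sup>2 - 2 * inner x y"
  by (simp add: power2_norm_eq_inner inner_diff inner_commute)

text \<open>
  If the directions nearly agree, the situation is essentially one-dimensional: the first two distance
  conditions make the norms grow by a factor of at least \<open>9/5\<close> at each step, and then \<open>w\<close> overshoots,
  being farther from \<open>u\<close> than \<open>v\<close> is.
\<close>

lemma no_expanding_triple_in_narrow_cone:
  fixes u v w :: "'a::real_inner"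
  assumes "v \<noteq> 0" "w \<noteq> 0"
    and uv: "inner u v \<ge> 9/10 * norm u * norm v"
    and vw: "inner v w \<ge> 9/10 * norm v * norm w"
    and "norm u \<le> norm (v - u)" and "norm v \<le> norm (w - v)"
    and wu: "norm (w - u) \<le> norm (v - u)"
  shows False
proof -
  have sep: "9/5 * norm a \<le> norm b"
    if "b \<noteq> 0" "norm a \<le> norm (b - a)" "inner a b \<ge> 9/10 * norm a * norm b" for a b :: 'a
  proof -
    have "(norm a)\<^sup>2 \<le> (norm (b - a))\<^sup>2"
      using that by (intro power_mono) auto
    also have "\<dots> = (norm a)\<^sup>2 + (norm b)\<^sup>2 - 2 * inner a b"
      by (simp add: norm_diff_squared inner_commute)
    finally have "2 * inner a b \<le> norm b * norm b" by (simp add: power2_eq_square)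
    with that have *: "(9/5 * norm a) * norm b \<le> norm b * norm b" by linarith
    then show ?thesis
      using \<open>b \<noteq> 0\<close> by (meson mult_right_le_imp_le zero_less_norm_iff)
  qed
  have 1: "9/5 * norm u \<le> norm v" and 2: "9/5 * norm v \<le> norm w"
    using assms sep by auto
  have "(norm (v - u))\<^sup>2 = (norm u)\<^sup>2 + (norm v)\<^sup>2 - 2 * inner u v"
    by (simp add: norm_diff_squared inner_commute)
  also have "\<dots> \<le> (norm v)\<^sup>2 - norm u * (9/5 * norm v - norm u)"
    using uv by (simp add: power2_eq_square algebra_simps)
  also have "\<dots> \<le> (norm v)\<^sup>2"
  proof -
    have "0 \<le> norm u * (9/5 * norm v - norm u)"
      using 1 norm_ge_zero[of u] norm_ge_zero[of v] by (intro mult_nonneg_nonneg) linarith+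
    then show ?thesis by simp
  qed
  finally have "norm (v - u) \<le> norm v"
    by (rule power2_le_imp_le) simp
  with wu norm_triangle_ineq2[of w u] 1 2 \<open>v \<noteq> 0\<close> show False
    using zero_less_norm_iff[of v] by linarith
qed

text \<open>
  The points \<open>w k\<close> are visited in order by a curve that ends at the origin and, once it has reached \<open>w j\<close>
  with \<open>j > k\<close>, no longer moves away from \<open>w k\<close>: this is where the distance conditions come from. The unit sphere is
  covered by finitely many small balls, and each of the corresponding cones contains at most two members
  of the sequence. Compactness of the sphere is what makes the bound uniform, and what ties it to finite
  dimension.
\<close>

lemma bounded_length_of_contracting_sequence:
  obtains N :: nat where "\<And>m (w :: nat \<Rightarrow> 'a::euclidean_space).
    \<lbrakk>\<And>k. k \<le> m \<Longrightarrow> w k \<noteq> 0;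
     \<And>k j. k < j \<Longrightarrow> j \<le> m \<Longrightarrow> norm (w k) \<le> norm (w j - w k);
     \<And>k j l. k < j \<Longrightarrow> j < l \<Longrightarrow> l \<le> m \<Longrightarrow> norm (w l - w k) \<le> norm (w j - w k)\<rbrakk>
    \<Longrightarrow> m < N"
proof -
  obtain C where C: "finite C" "sphere (0::'a) 1 \<subseteq> (\<Union>c\<in>C. ball c (1/5))"
    using compactE_image[OF compact_sphere[of "0::'a" 1], of "sphere (0::'a) 1" "\<lambda>c. ball c (1/5)"]
    by (metis (no_types, lifting) UN_iff centre_in_ball open_ball subsetI zero_less_divide_1_iff zero_less_numeral)
  have "m < 2 * card C"
    if nz: "\<And>k. k \<le> m \<Longrightarrow> w k \<noteq> 0"
      and far: "\<And>k j. k < j \<Longrightarrow> j \<le> m \<Longrightarrow> norm (w k) \<le> norm (w j - w k)"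
      and contr: "\<And>k j l. k < j \<Longrightarrow> j < l \<Longrightarrow> l \<le> m \<Longrightarrow> norm (w l - w k) \<le> norm (w j - w k)"
    for m and w :: "nat \<Rightarrow> 'a"
  proof -
    define I where "I c = {k. k \<le> m \<and> sgn (w k) \<in> ball c (1/5)}" for c
    have cone: "inner (w j) (w k) \<ge> 9/10 * norm (w j) * norm (w k)"
      if "j \<in> I c" "k \<in> I c" for j k c
    proof -
      let ?a = "sgn (w j)" and ?b = "sgn (w k)"
      have n: "norm ?a = 1" "norm ?b = 1"
        using that nz by (auto simp: I_def norm_sgn)
      (* Radius 1/5 gives cosine at least 1 - 2/25, which exceeds the 9/10 of the triple lemma. *)
      have "norm (?a - ?b) \<le> 2/5"
        using that dist_triangle2[of ?a ?b c] by (simp add: I_def dist_norm norm_minus_commute)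
      then have "(norm (?a - ?b))\<^sup>2 \<le> (2/5)\<^sup>2" by (intro power_mono) auto
      moreover have "(norm (?a - ?b))\<^sup>2 = 2 - 2 * inner ?a ?b"
        using n by (simp add: norm_diff_squared)
      ultimately have ab: "inner ?a ?b \<ge> 9/10" by (simp add: power2_eq_square)
      have "w j = norm (w j) *\<^sub>R ?a" "w k = norm (w k) *\<^sub>R ?b"
        by (auto simp: sgn_div_norm field_simps)
      then have "inner (w j) (w k) = norm (w j) * norm (w k) * inner ?a ?b"
        by (metis inner_scaleR_left inner_scaleR_right mult.assoc)
      also have "\<dots> \<ge> norm (w j) * norm (w k) * (9/10)"
        using ab by (intro mult_left_mono) auto
      finally show ?thesis by (simp add: mult_ac)
    qed
    have two: "card (I c) \<le> 2" for c
    proof (rule ccontr)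
      assume "\<not> card (I c) \<le> 2"
      then have fin: "finite (I c)" and "3 \<le> card (I c)" by (auto intro: card_ge_0_finite)
      then obtain T where T: "T \<subseteq> I c" "card T = 3"
        by (meson obtain_subset_with_card_n)
      then have T3: "sorted_list_of_set T ! 0 < sorted_list_of_set T ! 1"
          "sorted_list_of_set T ! 1 < sorted_list_of_set T ! 2"
        by (auto intro!: sorted_wrt_nth_less[OF strict_sorted_list_of_set])
      have "finite T" using T fin finite_subset by blast
      then have mem: "sorted_list_of_set T ! i \<in> I c" if "i < 3" for i
        using T that nth_mem[of i "sorted_list_of_set T"] by auto
      obtain k j l where kjl: "k < j" "j < l" "k \<in> I c" "j \<in> I c" "l \<in> I c"
        using T3 mem[of 0] mem[of 1] mem[of 2] by auto
      then have "l \<le> m" by (simp add: I_def)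
      show False
        by (rule no_expanding_triple_in_narrow_cone[where u = "w k" and v = "w j" and w = "w l"])
           (use kjl \<open>l \<le> m\<close> nz far contr cone in auto)
    qed
    have "{..m} \<subseteq> (\<Union>c\<in>C. I c)"
    proof
      fix k assume k: "k \<in> {..m}"
      then have "sgn (w k) \<in> sphere 0 1" using nz by (simp add: norm_sgn)
      with C obtain c where "c \<in> C" "sgn (w k) \<in> ball c (1/5)" by blast
      with k show "k \<in> (\<Union>c\<in>C. I c)" by (auto simp: I_def)
    qed
    moreover have "finite (\<Union>c\<in>C. I c)" using C by (auto simp: I_def)
    ultimately have "card {..m} \<le> card (\<Union>c\<in>C. I c)" by (rule card_mono[rotated])
    also have "\<dots> \<le> (\<Sum>c\<in>C. card (I c))" by (rule card_UN_le) (use C in auto)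
    also have "\<dots> \<le> (\<Sum>c\<in>C. 2)" by (rule sum_mono) (rule two)
    finally show ?thesis by simp
  qed
  then show thesis by (rule that)
qed

section \<open>Bounded increase along the flow\<close>

text \<open>
  A bound on the increase that does not depend on the length of the time interval, on \<open>F\<close>, or on the
  trajectory. If \<open>F (x T)\<close> were above \<open>F (x s) + N \<epsilon>\<close>, the curve would leave each of the levels
  \<open>F (x s) + k \<epsilon>\<close>, \<open>k \<le> N\<close>, for a last time \<open>e k\<close>. After the time \<open>e j\<close> the value stays more than \<open>\<epsilon>\<close>
  above the value at \<open>x (e k)\<close> for each \<open>k < j\<close>, so from then on the distance to \<open>x (e k)\<close>
  does not increase. The points \<open>x (e k)\<close>, seen from \<open>x T\<close>, thus form one of the sequences bounded
  above.
\<close>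

lemma approximate_subgradient_flow_rise:
  obtains N :: nat where
    "\<And>(F :: 'a::euclidean_space \<Rightarrow> real) x x' \<epsilon> s T.
      \<lbrakk>s \<le> T; \<epsilon> > 0; continuous_on {s..T} (\<lambda>\<tau>. F (x \<tau>));
       \<And>\<tau>. \<tau> \<in> {s..T} \<Longrightarrow> (x has_vector_derivative x' \<tau>) (at \<tau> within {s..T});
       \<And>\<tau> y. \<tau> \<in> {s..T} \<Longrightarrow> inner (x' \<tau>) (x \<tau> - y) \<le> F y + \<epsilon> - F (x \<tau>)\<rbrakk>
      \<Longrightarrow> F (x T) \<le> F (x s) + real N * \<epsilon>"
proof (rule bounded_length_of_contracting_sequence[where 'a='a])
  fix N :: nat
  assume N: "\<And>m (w :: nat \<Rightarrow> 'a).
     \<lbrakk>\<And>k. k \<le> m \<Longrightarrow> w k \<noteq> 0;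
      \<And>k j. k < j \<Longrightarrow> j \<le> m \<Longrightarrow> norm (w k) \<le> norm (w j - w k);
      \<And>k j l. k < j \<Longrightarrow> j < l \<Longrightarrow> l \<le> m \<Longrightarrow> norm (w l - w k) \<le> norm (w j - w k)\<rbrakk>
     \<Longrightarrow> m < N"
  have "F (x T) \<le> F (x s) + real N * \<epsilon>"
    if "s \<le> T" and "\<epsilon> > 0" and cont: "continuous_on {s..T} (\<lambda>\<tau>. F (x \<tau>))"
      and flow: "\<And>\<tau>. \<tau> \<in> {s..T} \<Longrightarrow> (x has_vector_derivative x' \<tau>) (at \<tau> within {s..T})"
      and sub: "\<And>\<tau> y. \<tau> \<in> {s..T} \<Longrightarrow> inner (x' \<tau>) (x \<tau> - y) \<le> F y + \<epsilon> - F (x \<tau>)"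
    for F :: "'a \<Rightarrow> real" and x x' \<epsilon> s T
  proof (rule ccontr)
    assume "\<not> ?thesis"
    then have high: "F (x T) > F (x s) + real N * \<epsilon>" by simp
    define A where "A k = {\<tau>\<in>{s..T}. F (x \<tau>) \<le> F (x s) + real k * \<epsilon>}" for k :: nat
    define e where "e k = Sup (A k)" for k
    have e_in: "e k \<in> A k" and e_ub: "\<And>\<tau>. \<tau> \<in> A k \<Longrightarrow> \<tau> \<le> e k" for k
    proof -
      have "closed (A k)"
        unfolding A_def by (rule continuous_on_closed_Collect_le[OF cont]) auto
      moreover have "s \<in> A k" using \<open>s \<le> T\<close> \<open>\<epsilon> > 0\<close> by (simp add: A_def)
      moreover have bdd: "bdd_above (A k)" by (rule bdd_aboveI[of _ T]) (simp add: A_def)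
      ultimately show "e k \<in> A k" unfolding e_def
        using closed_contains_Sup[of "A k"] by blast
      show "\<And>\<tau>. \<tau> \<in> A k \<Longrightarrow> \<tau> \<le> e k" unfolding e_def using bdd by (rule cSup_upper[rotated])
    qed
    have e_mono: "e k \<le> e j" if "k \<le> j" for k j
    proof (rule e_ub)
      have "real k * \<epsilon> \<le> real j * \<epsilon>" using that \<open>\<epsilon> > 0\<close> by simp
      with e_in[of k] show "e k \<in> A j" unfolding A_def by auto
    qed
    have approach: "norm (x b - x (e k)) \<le> norm (x (e j) - x (e k))"
      if "k < j" "e j \<le> b" "b \<le> T" for k j b
    proof (cases "e j = b")
      case False
      then have lt: "e j < b" using that by simp
      have s: "s \<le> e j" using e_in by (simp add: A_def)
      let ?d = "\<lambda>\<tau>. (norm (x \<tau> - x (e k)))\<^sup>2"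
      have "?d b \<le> ?d (e j)"
      proof (rule DERIV_nonpos_imp_decreasing_open[OF less_imp_le[OF lt]])
        fix \<tau> assume \<tau>: "e j < \<tau>" "\<tau> < b"
        then have in_int: "\<tau> \<in> {s<..<T}" using s that by auto
        then have "(x has_vector_derivative x' \<tau>) (at \<tau>)"
          using flow[of \<tau>] by (simp add: has_vector_derivative_def at_within_Icc_at)
        then have "(?d has_real_derivative 2 * inner (x' \<tau>) (x \<tau> - x (e k))) (at \<tau>)"
          unfolding power2_norm_eq_inner has_real_derivative_iff_has_vector_derivative
            has_vector_derivative_def
          by (auto intro!: derivative_eq_intros simp: inner_commute algebra_simps)
        moreover have "inner (x' \<tau>) (x \<tau> - x (e k)) \<le> 0"
        proof -
          have "\<tau> \<notin> A j" using e_ub[of \<tau> j] \<tau> by linarith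
          then have "F (x \<tau>) > F (x s) + real j * \<epsilon>" using in_int by (auto simp: A_def)
          moreover have "F (x (e k)) \<le> F (x s) + real k * \<epsilon>" using e_in by (simp add: A_def)
          moreover have "real (Suc k) * \<epsilon> \<le> real j * \<epsilon>"
            using that \<open>\<epsilon> > 0\<close> by (intro mult_right_mono) auto
          ultimately have "F (x (e k)) + \<epsilon> - F (x \<tau>) \<le> 0" by (simp add: algebra_simps)
          then show ?thesis using sub[of \<tau> "x (e k)"] in_int by auto
        qed
        ultimately show "\<exists>y. (?d has_real_derivative y) (at \<tau>) \<and> y \<le> 0"
          by (intro exI[of _ "2 * inner (x' \<tau>) (x \<tau> - x (e k))"] conjI) auto
      next
        have "continuous_on {s..T} x"
          using flow by (meson continuous_on_eq_continuous_within has_vector_derivative_continuous)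
        then have "continuous_on {e j..b} x"
          by (rule continuous_on_subset) (use s that in auto)
        then show "continuous_on {e j..b} ?d" by (intro continuous_intros)
      qed
      then show ?thesis by (rule power2_le_imp_le) simp
    qed simp
    define w where "w k = x (e k) - x T" for k
    have eT: "e k \<le> T" for k using e_in[of k] by (simp add: A_def)
    have "N < N"
    proof (rule N[of N w])
      fix k assume "k \<le> N"
      then have "real k * \<epsilon> \<le> real N * \<epsilon>" using \<open>\<epsilon> > 0\<close> by simp
      then have "F (x (e k)) < F (x T)" using e_in[of k] high by (auto simp: A_def)
      then show "w k \<noteq> 0" by (auto simp: w_def)
    next
      fix k j :: nat assume "k < j"
      then show "norm (w k) \<le> norm (w j - w k)"
        using approach[OF _ eT order_refl, of k j]
        by (simp add: w_def norm_minus_commute[of "x (e k)" "x T"])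
    next
      fix k j l :: nat assume "k < j" "j < l"
      then show "norm (w l - w k) \<le> norm (w j - w k)"
        using approach[OF _ e_mono eT] by (auto simp: w_def)
    qed
    then show False by simp
  qed
  then show thesis by (rule that)
qed

section \<open>Smoothed gradients as approximate subgradients\<close>

lemma convex_on_above_tangent_plane:
  fixes G :: "'a::real_inner \<Rightarrow> real"
  assumes "convex_on UNIV G" "GDERIV G x :> g"
  shows "inner g (y - x) \<le> G y - G x"
proof -
  let ?l = "\<lambda>r::real. x + r *\<^sub>R (y - x)"
  have "convex_on UNIV (\<lambda>r. G (?l r))"
  proof (rule convex_onI)
    fix t r s :: real assume "0 < t" "t < 1"
    have "?l ((1 - t) *\<^sub>R r + t *\<^sub>R s) = (1 - t) *\<^sub>R ?l r + t *\<^sub>R ?l s"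
      by (simp add: algebra_simps)
    then show "G (?l ((1 - t) *\<^sub>R r + t *\<^sub>R s)) \<le> (1 - t) * G (?l r) + t * G (?l s)"
      using convex_onD[OF assms(1), of t "?l r" "?l s"] \<open>0 < t\<close> \<open>t < 1\<close> by simp
  qed simp
  moreover have "((\<lambda>r. G (?l r)) has_real_derivative inner (y - x) g) (at 0)"
  proof -
    have "(?l has_derivative (\<lambda>r. r *\<^sub>R (y - x))) (at 0)"
      by (auto intro!: derivative_eq_intros)
    moreover have "(G has_derivative (\<lambda>h. inner h g)) (at (?l 0))"
      using assms(2) by (simp add: gderiv_def)
    ultimately have "((\<lambda>r. G (?l r)) has_derivative (\<lambda>r. inner (r *\<^sub>R (y - x)) g)) (at 0)"
      by (rule has_derivative_compose)
    then show ?thesis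
      by (simp add: has_field_derivative_def mult_commute_abs)
  qed
  ultimately have "inner (y - x) g * (1 - 0) \<le> G (?l 1) - G (?l 0)"
    by (intro convex_on_imp_above_tangent) auto
  then show ?thesis by (simp add: inner_commute)
qed

text \<open>
  The tangent plane inequality for \<open>q\<close> minus the quadratic, with the quadratic terms collected on the
  left.
\<close>

lemma strongly_convex_above_paraboloid:
  fixes q :: "'a::euclidean_space \<Rightarrow> real"
  assumes "convex_on UNIV (\<lambda>y. q y - \<sigma> / 2 * (norm y)\<^sup>2)" "q differentiable (at x)"
  shows "inner (grad q x) (y - x) + \<sigma> / 2 * (norm (y - x))\<^sup>2 \<le> q y - q x"
proof -
  have "GDERIV (\<lambda>y. q y - \<sigma> / 2 * (norm y)\<^sup>2) x :> grad q x - \<sigma> *\<^sub>R x"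
    using GDERIV_grad[OF assms(2)] unfolding gderiv_def power2_norm_eq_inner
    by (auto intro!: derivative_eq_intros simp: inner_diff_right inner_commute algebra_simps)
  from convex_on_above_tangent_plane[OF assms(1) this, of y]
  have "inner (grad q x) (y - x) - \<sigma> * inner x (y - x)
      \<le> q y - q x - \<sigma> / 2 * ((norm y)\<^sup>2 - (norm x)\<^sup>2)"
    by (simp add: inner_diff_left algebra_simps)
  moreover have "\<sigma> / 2 * (norm (y - x))\<^sup>2
      = \<sigma> / 2 * ((norm y)\<^sup>2 - (norm x)\<^sup>2) - \<sigma> * inner x (y - x)"
    unfolding norm_diff_squared power2_norm_eq_inner
    by (simp add: inner_diff_right inner_commute field_simps)
  ultimately show ?thesis by linarith
qed

text \<open>
  The lower bound \<open>ht \<le> h\<close> is used at the comparison point \<open>y\<close> and the upper bound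
  \<open>h \<le> ht + \<beta> m\<close> at the current point \<open>z\<close>; the gap between the two is the error \<open>\<beta> m\<close>.
\<close>

lemma smoothed_gradient_is_approximate_subgradient:
  fixes f h :: "'a::euclidean_space \<Rightarrow> real"
  assumes f: "strongly_convex \<sigma> f" "smooth_fun L f"
    and ht: "smooth_approximation \<alpha> \<beta> h ht" and "m > 0"
  shows "inner (- grad (\<lambda>y. f y + ht y m) z) (z - y)
    \<le> (f y + h y) + \<beta> * m - (f z + h z) - \<sigma> / 2 * (norm (z - y))\<^sup>2"
proof -
  let ?q = "\<lambda>y. f y + ht y m"
  have ht': "convex_on UNIV (\<lambda>y. ht y m)" "(\<lambda>y. ht y m) differentiable (at z)"
      "ht y m \<le> h y" "h z \<le> ht z m + \<beta> * m"
    using ht \<open>m > 0\<close> by (auto simp: smooth_approximation_def smooth_fun_def)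
  have "convex_on UNIV (\<lambda>y. (f y - \<sigma> / 2 * (norm y)\<^sup>2) + ht y m)"
    using f(1) ht'(1) by (intro convex_on_add) (auto simp: strongly_convex_def)
  then have "convex_on UNIV (\<lambda>y. ?q y - \<sigma> / 2 * (norm y)\<^sup>2)"
    by (simp add: algebra_simps)
  moreover have "?q differentiable (at z)"
    using f(2) ht'(2) by (auto simp: smooth_fun_def)
  ultimately have "inner (grad ?q z) (y - z) + \<sigma> / 2 * (norm (y - z))\<^sup>2 \<le> ?q y - ?q z"
    by (rule strongly_convex_above_paraboloid)
  moreover have "inner (- grad ?q z) (z - y) = inner (grad ?q z) (y - z)"
    by (simp add: inner_diff_right)
  ultimately show ?thesis using ht' by (simp add: norm_minus_commute)
qed

section \<open>The weighted energy estimate\<close>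

text \<open>
  The bound on the increase replaces \<open>F (x \<tau>)\<close> at earlier times by the final value \<open>F (x t)\<close>, at the
  cost of \<open>N e(\<tau>)\<close>. As that value is a constant on \<open>[t0, t]\<close>, the distance estimate bounds it directly
  and not just an average. The exponential weight is the integrating factor that absorbs the strong
  convexity term.
\<close>

lemma approximate_subgradient_flow_energy:
  fixes F :: "'a::euclidean_space \<Rightarrow> real"
  assumes cont: "continuous_on {t0..} (\<lambda>\<tau>. F (x \<tau>))"
    and flow: "\<And>\<tau>. \<tau> \<ge> t0 \<Longrightarrow> (x has_vector_derivative x' \<tau>) (at \<tau> within {t0..})"
    and sub: "\<And>\<tau> y. \<tau> \<ge> t0 \<Longrightarrow>
      inner (x' \<tau>) (x \<tau> - y) \<le> F y + e \<tau> - F (x \<tau>) - \<sigma> / 2 * (norm (x \<tau> - y))\<^sup>2"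
    and e_pos: "\<And>\<tau>. \<tau> \<ge> t0 \<Longrightarrow> e \<tau> > 0"
    and e_antimono: "\<And>\<tau> \<tau>'. t0 \<le> \<tau> \<Longrightarrow> \<tau> \<le> \<tau>' \<Longrightarrow> e \<tau>' \<le> e \<tau>"
    and e_cont: "continuous_on {t0..} e"
    and "\<sigma> \<ge> 0"
  obtains K where "K \<ge> 0" "\<And>t. t \<ge> t0 \<Longrightarrow>
    (F (x t) - F z) * integral {t0..t} (\<lambda>\<tau>. exp (\<sigma> * (\<tau> - t0)))
      \<le> (norm (x t0 - z))\<^sup>2 / 2 + K * integral {t0..t} (\<lambda>\<tau>. exp (\<sigma> * (\<tau> - t0)) * e \<tau>)"
proof (rule approximate_subgradient_flow_rise[where 'a='a])
  fix N :: nat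
  assume N: "\<And>(F :: 'a \<Rightarrow> real) x x' \<epsilon> s T.
      \<lbrakk>s \<le> T; \<epsilon> > 0; continuous_on {s..T} (\<lambda>\<tau>. F (x \<tau>));
       \<And>\<tau>. \<tau> \<in> {s..T} \<Longrightarrow> (x has_vector_derivative x' \<tau>) (at \<tau> within {s..T});
       \<And>\<tau> y. \<tau> \<in> {s..T} \<Longrightarrow> inner (x' \<tau>) (x \<tau> - y) \<le> F y + \<epsilon> - F (x \<tau>)\<rbrakk>
      \<Longrightarrow> F (x T) \<le> F (x s) + real N * \<epsilon>"
  have rise: "F (x t) \<le> F (x \<tau>) + real N * e \<tau>" if "t0 \<le> \<tau>" "\<tau> \<le> t" for \<tau> t
  proof (rule N[of \<tau> t "e \<tau>" F x x'])
    show "continuous_on {\<tau>..t} (\<lambda>\<tau>. F (x \<tau>))"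
      by (rule continuous_on_subset[OF cont]) (use that in auto)
    fix u assume u: "u \<in> {\<tau>..t}"
    then have "u \<ge> t0" using that by simp
    show "(x has_vector_derivative x' u) (at u within {\<tau>..t})"
      by (rule has_vector_derivative_within_subset[OF flow[OF \<open>u \<ge> t0\<close>]]) (use that in auto)
    fix y
    have "0 \<le> \<sigma> / 2 * (norm (x u - y))\<^sup>2" using \<open>\<sigma> \<ge> 0\<close> by simp
    moreover have "e u \<le> e \<tau>" using u that by (intro e_antimono) auto
    ultimately show "inner (x' u) (x u - y) \<le> F y + e \<tau> - F (x u)"
      using sub[OF \<open>u \<ge> t0\<close>, of y] by linarith
  qed (use that e_pos in auto)
  have "(F (x t) - F z) * integral {t0..t} (\<lambda>\<tau>. exp (\<sigma> * (\<tau> - t0)))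
      \<le> (norm (x t0 - z))\<^sup>2 / 2
        + (real N + 1) * integral {t0..t} (\<lambda>\<tau>. exp (\<sigma> * (\<tau> - t0)) * e \<tau>)"
    if "t \<ge> t0" for t
  proof -
    define c where "c = F (x t) - F z"
    let ?p = "\<lambda>\<tau>. exp (\<sigma> * (\<tau> - t0))"
    let ?E = "\<lambda>\<tau>. ?p \<tau> * ((norm (x \<tau> - z))\<^sup>2 / 2)"
    let ?W = "\<lambda>\<tau>. integral {t0..\<tau>} ?p"
    let ?M = "\<lambda>\<tau>. integral {t0..\<tau>} (\<lambda>\<tau>. ?p \<tau> * e \<tau>)"
    (* The final gap c enters as a constant: this function of the earlier time decreases because the gap
       at that time is at least c up to the allowed increase. *)
    let ?V = "\<lambda>\<tau>. ?E \<tau> + c * ?W \<tau> - (real N + 1) * ?M \<tau>"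
    let ?V' = "\<lambda>\<tau>. ?p \<tau> * (\<sigma> / 2 * (norm (x \<tau> - z))\<^sup>2 + inner (x' \<tau>) (x \<tau> - z)
                    + c - (real N + 1) * e \<tau>)"
    have cont_e: "continuous_on {t0..t} e"
      by (rule continuous_on_subset[OF e_cont]) auto
    have der: "(?V has_real_derivative ?V' \<tau>) (at \<tau> within {t0..t})" if "\<tau> \<in> {t0..t}" for \<tau>
    proof -
      have W: "(?W has_real_derivative ?p \<tau>) (at \<tau> within {t0..t})"
        by (rule integral_has_real_derivative[OF _ that]) (intro continuous_intros)
      have M: "(?M has_real_derivative ?p \<tau> * e \<tau>) (at \<tau> within {t0..t})"
        by (rule integral_has_real_derivative[OF _ that]) (intro continuous_intros cont_e)
      have "(x has_vector_derivative x' \<tau>) (at \<tau> within {t0..t})"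
        using flow[of \<tau>] that by (auto intro: has_vector_derivative_within_subset)
      then have Q: "((\<lambda>\<tau>. (norm (x \<tau> - z))\<^sup>2) has_real_derivative
          2 * inner (x' \<tau>) (x \<tau> - z)) (at \<tau> within {t0..t})"
        unfolding power2_norm_eq_inner has_real_derivative_iff_has_vector_derivative
          has_vector_derivative_def
        by (auto intro!: derivative_eq_intros simp: inner_commute algebra_simps)
      have P: "(?p has_real_derivative \<sigma> * ?p \<tau>) (at \<tau> within {t0..t})"
        by (auto intro!: derivative_eq_intros)
      show ?thesis
        by (rule DERIV_cong[OF DERIV_diff[OF DERIV_add[OF DERIV_mult[OF P DERIV_cdivide[OF Q, of 2]]
              DERIV_cmult[OF W, of c]] DERIV_cmult[OF M, of "real N + 1"]]])
           (simp add: field_simps)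
    qed
    have "?V t \<le> ?V t0"
    proof (rule DERIV_nonpos_imp_decreasing_open[OF that])
      fix \<tau> assume \<tau>: "t0 < \<tau>" "\<tau> < t"
      then have "(?V has_real_derivative ?V' \<tau>) (at \<tau>)"
        using der[of \<tau>] by (simp add: at_within_Icc_at)
      moreover have "?V' \<tau> \<le> 0"
      proof (rule mult_nonneg_nonpos)
        show "\<sigma> / 2 * (norm (x \<tau> - z))\<^sup>2 + inner (x' \<tau>) (x \<tau> - z) + c - (real N + 1) * e \<tau> \<le> 0"
          using sub[of \<tau> z] rise[of \<tau> t] \<tau> by (simp add: c_def algebra_simps)
      qed simp
      ultimately show "\<exists>y. (?V has_real_derivative y) (at \<tau>) \<and> y \<le> 0"
        by (intro exI[of _ "?V' \<tau>"] conjI)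
    next
      show "continuous_on {t0..t} ?V"
        using der by (meson DERIV_continuous continuous_on_eq_continuous_within)
    qed
    then have "?E t + c * ?W t \<le> (norm (x t0 - z))\<^sup>2 / 2 + (real N + 1) * ?M t"
      by simp
    moreover have "0 \<le> ?E t" by simp
    ultimately show ?thesis unfolding c_def by linarith
  qed
  then show thesis by (intro that[of "real N + 1"]) auto
qed

section \<open>Limits and rates from the energy estimate\<close>

lemma average_tendsto_0:
  fixes e :: "real \<Rightarrow> real"
  assumes cont: "continuous_on {t0..} e" and lim: "(e \<longlongrightarrow> 0) at_top"
  shows "((\<lambda>t. integral {t0..t} e / (t - t0)) \<longlongrightarrow> 0) at_top"
proof (rule lhospital_at_top_at_top)
  show "\<forall>\<^sub>F t in at_top. ((\<lambda>t. integral {t0..t} e) has_real_derivative e t) (at t)"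
    using eventually_gt_at_top[of t0]
  proof eventually_elim
    case (elim t)
    have "((\<lambda>t. integral {t0..t} e) has_real_derivative e t) (at t within {t0..t+1})"
      using elim by (intro integral_has_real_derivative continuous_on_subset[OF cont]) auto
    then show ?case using elim by (simp add: at_within_Icc_at)
  qed
  show "LIM t at_top. t - t0 :> at_top"
    using filterlim_tendsto_add_at_top[OF tendsto_const[of "- t0"] filterlim_ident] by simp
  show "\<forall>\<^sub>F t in at_top. ((\<lambda>t. t - t0) has_real_derivative 1) (at t)"
    by (auto intro!: always_eventually derivative_eq_intros)
qed (use lim in auto)

lemma integral_le_improper_integral:
  fixes g :: "real \<Rightarrow> real"
  assumes "set_integrable lborel {t0..} g" "\<And>\<tau>. \<tau> \<ge> t0 \<Longrightarrow> g \<tau> \<ge> 0"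
  shows "integral {t0..t} g \<le> integral {t0..} g"
proof (rule integral_subset_le)
  show "g integrable_on {t0..}" "g integrable_on {t0..t}"
    using assms(1) set_integrable_subset[OF assms(1), of "{t0..t}"]
    by (auto intro: set_borel_integral_eq_integral)
qed (use assms in auto)

lemma bigO_exp_if_weighted_bound:
  assumes "\<sigma> > 0" and bound: "\<And>t. t \<ge> t0 \<Longrightarrow> a t * integral {t0..t} (\<lambda>\<tau>. exp (\<sigma> * (\<tau> - t0))) \<le> B"
  shows "bigO_from t0 a (\<lambda>t. exp (- \<sigma> * t))"
  unfolding bigO_from_def
proof (intro exI conjI allI impI)
  let ?b = "1 + \<bar>B\<bar>" and ?d = "(1 - exp (- \<sigma>)) / \<sigma>"
  have d: "?d > 0" using \<open>\<sigma> > 0\<close> by simp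
  show "0 < ?b * exp (\<sigma> * t0) / ?d" by (rule divide_pos_pos[OF mult_pos_pos d]) auto
  show "t0 \<le> t0 + 1" by simp
  fix t assume t: "t \<ge> t0 + 1"
  have "((\<lambda>\<tau>. exp (\<sigma> * (\<tau> - t0))) has_integral exp (\<sigma> * (t - t0)) / \<sigma> - exp (\<sigma> * (t0 - t0)) / \<sigma>) {t0..t}"
    using t \<open>\<sigma> > 0\<close>
    by (intro fundamental_theorem_of_calculus)
       (auto intro!: derivative_eq_intros simp flip: has_real_derivative_iff_has_vector_derivative)
  then have W: "integral {t0..t} (\<lambda>\<tau>. exp (\<sigma> * (\<tau> - t0))) = (exp (\<sigma> * (t - t0)) - 1) / \<sigma>"
    by (simp add: integral_unique diff_divide_distrib)
  (* One unit of time after t0 the weight has grown by a factor exp \<sigma>, so subtracting 1 in the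
     numerator of the integral costs only the constant factor 1 - exp (- \<sigma>). *)
  have "1 \<le> exp (- \<sigma>) * exp (\<sigma> * (t - t0))"
  proof -
    have "0 \<le> \<sigma> * (t - t0 - 1)" using t \<open>\<sigma> > 0\<close> by simp
    then show ?thesis by (simp add: algebra_simps flip: exp_add)
  qed
  then have "?d * exp (\<sigma> * (t - t0)) \<le> (exp (\<sigma> * (t - t0)) - 1) / \<sigma>"
    using \<open>\<sigma> > 0\<close> by (simp add: field_simps)
  show "a t \<le> ?b * exp (\<sigma> * t0) / ?d * exp (- \<sigma> * t)"
  proof (cases "a t \<le> 0")
    case True
    then show ?thesis using d by (smt (verit) divide_nonneg_pos exp_gt_zero mult_nonneg_nonneg)
  next
    case False
    have "a t * (?d * exp (\<sigma> * (t - t0))) \<le> a t * ((exp (\<sigma> * (t - t0)) - 1) / \<sigma>)"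
      using False \<open>?d * _ \<le> _\<close> by (intro mult_left_mono) auto
    also have "\<dots> \<le> ?b" using bound[of t] t W by simp
    finally have "a t \<le> ?b / (?d * exp (\<sigma> * (t - t0)))"
      by (simp only: pos_le_divide_eq[OF mult_pos_pos[OF d exp_gt_zero]])
    also have "\<dots> = ?b * exp (\<sigma> * t0) / ?d * exp (- \<sigma> * t)"
      by (simp add: exp_diff exp_minus right_diff_distrib field_simps)
    finally show ?thesis .
  qed
qed

lemma bigO_inverse_if_weighted_bound:
  assumes bound: "\<And>t. t \<ge> t0 \<Longrightarrow> a t * (t - t0) \<le> B"
  shows "bigO_from t0 a (\<lambda>t. 1 / t)"
  unfolding bigO_from_def
proof (intro exI conjI allI impI)
  show "0 < 2 * (1 + \<bar>B\<bar>)" by simp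
  show "t0 \<le> 2 * \<bar>t0\<bar> + 1" by simp
  fix t assume t: "t \<ge> 2 * \<bar>t0\<bar> + 1"
  then have half: "0 < t" "t / 2 \<le> t - t0" by auto
  show "a t \<le> 2 * (1 + \<bar>B\<bar>) * (1 / t)"
  proof (cases "a t \<le> 0")
    case True
    then show ?thesis using half by (smt (verit) divide_nonneg_pos mult_nonneg_nonneg)
  next
    case False
    then have "a t * (t / 2) \<le> a t * (t - t0)" using half by (intro mult_left_mono) auto
    also have "\<dots> \<le> 1 + \<bar>B\<bar>"
    proof -
      have "t0 \<le> t" using t by linarith
      from bound[OF this] show ?thesis by linarith
    qed
    finally show ?thesis using half by (simp add: field_simps)
  qed
qed

theorem corollary1:
  fixes f h F :: "real ^ 'n \<Rightarrow> real"
    and ht Ft :: "real ^ 'n \<Rightarrow> real \<Rightarrow> real"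
    and x :: "real \<Rightarrow> real ^ 'n" and xstar :: "real ^ 'n"
    and \<mu> \<mu>' :: "real \<Rightarrow> real"
    and \<sigma> L \<alpha> \<beta> t0 :: real
  assumes "\<sigma> \<ge> 0" and "L \<ge> 0"
    and "strongly_convex \<sigma> f" and "smooth_fun L f"
    and "convex_on UNIV h"
    and "smooth_approximation \<alpha> \<beta> h ht"
    and F: "F = (\<lambda>y. f y + h y)"
    and Ft: "Ft = (\<lambda>y m. f y + ht y m)"
    and "\<forall>y. F xstar \<le> F y"
    and "\<And>t. t \<ge> t0 \<Longrightarrow> \<mu> t > 0"
    and "\<And>t. t \<ge> t0 \<Longrightarrow> (\<mu> has_real_derivative \<mu>' t) (at t within {t0..})"
    and "\<And>t. t \<ge> t0 \<Longrightarrow> \<mu>' t \<le> 0"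
    and "(\<mu> \<longlongrightarrow> 0) at_top"
    and "\<And>t. t \<ge> t0 \<Longrightarrow>
           (x has_vector_derivative - grad (\<lambda>y. Ft y (\<mu> t)) (x t)) (at t within {t0..})"
  shows "((\<lambda>t. F (x t)) \<longlongrightarrow> F xstar) at_top \<and>
         (set_integrable lborel {t0..} (\<lambda>\<tau>. exp (\<sigma> * (\<tau> - t0)) * \<mu> \<tau>) \<longrightarrow>
            (\<sigma> > 0 \<longrightarrow> bigO_from t0 (\<lambda>t. F (x t) - F xstar) (\<lambda>t. exp (- \<sigma> * t))) \<and>
            (\<sigma> = 0 \<longrightarrow> bigO_from t0 (\<lambda>t. F (x t) - F xstar) (\<lambda>t. 1 / t)))"
proof -
  define e where "e \<tau> = \<beta> * \<mu> \<tau>" for \<tau>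
  define x' where "x' \<tau> = - grad (\<lambda>y. Ft y (\<mu> \<tau>)) (x \<tau>)" for \<tau>
  define \<phi> where "\<phi> t = F (x t) - F xstar" for t
  define D where "D = (norm (x t0 - xstar))\<^sup>2 / 2"
  have "\<beta> > 0" using assms(6) by (simp add: smooth_approximation_def)
  have \<phi>_nonneg: "0 \<le> \<phi> t" for t using assms(9) by (simp add: \<phi>_def)
  have \<mu>_cont: "continuous_on {t0..} \<mu>"
    using assms(11) by (meson DERIV_continuous atLeast_iff continuous_on_eq_continuous_within)
  have \<mu>_antimono: "\<mu> b \<le> \<mu> a" if "t0 \<le> a" "a \<le> b" for a b
  proof (rule DERIV_nonpos_imp_decreasing_open[OF that(2)])
    fix \<tau> assume "a < \<tau>" "\<tau> < b"
    then have "t0 < \<tau>" using that by simp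
    then have "at \<tau> within {t0..} = at \<tau>"
      by (intro at_within_interior) simp
    then show "\<exists>y. (\<mu> has_real_derivative y) (at \<tau>) \<and> y \<le> 0"
      using assms(11)[of \<tau>] assms(12)[of \<tau>] \<open>t0 < \<tau>\<close> by auto
  qed (use \<mu>_cont that in \<open>auto elim: continuous_on_subset\<close>)
  have e: "\<And>\<tau>. \<tau> \<ge> t0 \<Longrightarrow> e \<tau> > 0"
      "\<And>\<tau> \<tau>'. t0 \<le> \<tau> \<Longrightarrow> \<tau> \<le> \<tau>' \<Longrightarrow> e \<tau>' \<le> e \<tau>"
      "continuous_on {t0..} e" "(e \<longlongrightarrow> 0) at_top"
    using \<open>\<beta> > 0\<close> assms(10) \<mu>_antimono \<mu>_cont tendsto_mult_left[OF assms(13), of \<beta>]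
    by (auto simp: e_def[abs_def] intro!: continuous_intros)
  have flow: "(x has_vector_derivative x' \<tau>) (at \<tau> within {t0..})" if "\<tau> \<ge> t0" for \<tau>
    using assms(14) that by (simp add: x'_def)
  have sub: "inner (x' \<tau>) (x \<tau> - y)
      \<le> F y + e \<tau> - F (x \<tau>) - \<sigma> / 2 * (norm (x \<tau> - y))\<^sup>2" if "\<tau> \<ge> t0" for \<tau> y
    using smoothed_gradient_is_approximate_subgradient[OF assms(3,4,6), of "\<mu> \<tau>" "x \<tau>" y]
      assms(10) that by (simp add: x'_def e_def F Ft)
  have "continuous_on UNIV f"
    using assms(4)
    by (auto simp: smooth_fun_def continuous_on_eq_continuous_at intro: differentiable_imp_continuous_within)
  then have "continuous_on UNIV F"
    unfolding F using convex_on_continuous[OF open_UNIV assms(5)] by (intro continuous_intros)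
  moreover have "continuous_on {t0..} x"
    using flow by (meson atLeast_iff continuous_on_eq_continuous_within has_vector_derivative_continuous)
  ultimately have cont: "continuous_on {t0..} (\<lambda>\<tau>. F (x \<tau>))"
    by (auto intro: continuous_on_compose2)
  have "(\<phi> \<longlongrightarrow> 0) at_top"
  proof -
    (* Dropping the strong convexity term makes the energy estimate available with weight 1. *)
    have sub0: "inner (x' \<tau>) (x \<tau> - y) \<le> F y + e \<tau> - F (x \<tau>) - 0 / 2 * (norm (x \<tau> - y))\<^sup>2"
      if "\<tau> \<ge> t0" for \<tau> y
    proof -
      have "0 \<le> \<sigma> / 2 * (norm (x \<tau> - y))\<^sup>2" using \<open>\<sigma> \<ge> 0\<close> by simp
      then show ?thesis using sub[OF that, of y] by simp
    qed
    obtain K where K: "\<And>t. t \<ge> t0 \<Longrightarrow> \<phi> t * integral {t0..t} (\<lambda>\<tau>. exp (0 * (\<tau> - t0)))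
        \<le> D + K * integral {t0..t} (\<lambda>\<tau>. exp (0 * (\<tau> - t0)) * e \<tau>)"
      using approximate_subgradient_flow_energy[OF cont flow sub0 e(1-3), of xstar]
      unfolding \<phi>_def D_def by auto
    have "\<forall>\<^sub>F t in at_top. \<phi> t \<le> D / (t - t0) + K * (integral {t0..t} e / (t - t0))"
      using eventually_gt_at_top[of t0]
    proof eventually_elim
      case (elim t)
      then have "\<phi> t * (t - t0) \<le> D + K * integral {t0..t} e" using K[of t] by simp
      then have "\<phi> t \<le> (D + K * integral {t0..t} e) / (t - t0)"
        using elim by (simp add: pos_le_divide_eq)
      then show ?case by (simp add: add_divide_distrib)
    qed
    moreover have "((\<lambda>t. D / (t - t0) + K * (integral {t0..t} e / (t - t0))) \<longlongrightarrow> 0) at_top"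
    proof -
      have "LIM t at_top. t - t0 :> at_top"
        using filterlim_tendsto_add_at_top[OF tendsto_const[of "- t0"] filterlim_ident] by simp
      then have "((\<lambda>t. D / (t - t0)) \<longlongrightarrow> 0) at_top"
        by (intro tendsto_divide_0[OF tendsto_const] filterlim_at_top_imp_at_infinity)
      from tendsto_add[OF this tendsto_mult_left[OF average_tendsto_0[OF e(3,4)], of K]]
      show ?thesis by simp
    qed
    ultimately show ?thesis
      by (rule tendsto_sandwich[OF always_eventually _ tendsto_const, rotated]) (simp add: \<phi>_nonneg)
  qed
  then have "((\<lambda>t. F (x t)) \<longlongrightarrow> F xstar) at_top"
    unfolding \<phi>_def by (simp add: LIM_zero_iff)
  moreover have "(\<sigma> > 0 \<longrightarrow> bigO_from t0 \<phi> (\<lambda>t. exp (- \<sigma> * t))) \<and>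
      (\<sigma> = 0 \<longrightarrow> bigO_from t0 \<phi> (\<lambda>t. 1 / t))"
    if int: "set_integrable lborel {t0..} (\<lambda>\<tau>. exp (\<sigma> * (\<tau> - t0)) * \<mu> \<tau>)"
  proof -
    let ?W = "\<lambda>t. integral {t0..t} (\<lambda>\<tau>. exp (\<sigma> * (\<tau> - t0)))"
    let ?g = "\<lambda>\<tau>. exp (\<sigma> * (\<tau> - t0)) * e \<tau>"
    obtain K where "K \<ge> 0" and K: "\<And>t. t \<ge> t0 \<Longrightarrow> \<phi> t * ?W t \<le> D + K * integral {t0..t} ?g"
      using approximate_subgradient_flow_energy[OF cont flow sub e(1-3) \<open>\<sigma> \<ge> 0\<close>, of xstar]
      unfolding \<phi>_def D_def by blast
    have "set_integrable lborel {t0..} ?g"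
      using set_integrable_mult_right[OF int, of \<beta>] by (simp add: e_def mult_ac)
    then have "integral {t0..t} ?g \<le> integral {t0..} ?g" for t
      by (rule integral_le_improper_integral) (use e(1) in \<open>simp add: less_imp_le\<close>)
    then have B: "\<phi> t * ?W t \<le> D + K * integral {t0..} ?g" if "t \<ge> t0" for t
      by (rule order_trans[OF K[OF that] add_left_mono[OF mult_left_mono[OF _ \<open>K \<ge> 0\<close>]]])
    show ?thesis
    proof (intro conjI impI)
      assume "\<sigma> > 0"
      then show "bigO_from t0 \<phi> (\<lambda>t. exp (- \<sigma> * t))"
        using B by (rule bigO_exp_if_weighted_bound)
    next
      assume "\<sigma> = 0"
      then show "bigO_from t0 \<phi> (\<lambda>t. 1 / t)"
        by (intro bigO_inverse_if_weighted_bound) (use B in auto)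
    qed
  qed
  ultimately show ?thesis by (auto simp: \<phi>_def[abs_def])
qed

end
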